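(* Assume that $f_{\mathcal H}$ is $L$-smooth and satisfies the PL condition with parameter $\mu>0$, that the honest local objectives satisfy the $(G,B)$-bounded dissimilarity condition, that the stochastic gradients satisfy the stochastic first-order oracle assumption with variance bound $\sigma^2$, and that the aggregation rule $\mathcal A$ is $(b,\kappa)$-robust. For any $0<\delta<1/4$, denote $$\alpha_1=2\mu\left(\tfrac12-2\delta-\kappa B^2\left(\tfrac12+\delta\right)\right),\quad \alpha_2=L\left(\frac{2\sigma^2}{h}+\kappa\sigma^2+\kappa G^2\right),\quad \alpha_3=\tfrac12\left(\kappa\sigma^2+\kappa G^2\right).$$ Assume $\kappa B^2<\frac{1-4\delta}{1+2\delta}$. For any given integer $T>0$, suppose that the stepsizes are chosen as $$\gamma_t=\begin{cases}\gamma_0,& t<\lfloor T/2\rfloor,\\ \dfrac{2}{\alpha_1\left(s_0+t-\lfloor T/2\rfloor\right)},& t\ge\lfloor T/2\rfloor,\end{cases}$$ with $s_0>\max\{\frac{2L}{\delta\alpha_1},2\}$ and $\gamma_0=\frac{2}{\alpha_1s_0}<\min\{\frac1{\alpha_1},\frac{\delta}{L}\}$. Then the iterates generated by R-DSGD satisfy $$\mathbb E[f_{\mathcal H}(x^{T-1})]-f_{\mathcal H}^*\le (s_0-1)^2\left(f_{\mathcal H}(x^0)-f_{\mathcal H}^*\right)\frac{4\exp\left(-\alpha_1\gamma_0(\lfloor T/2\rfloor-1)\right)}{T^2}+\frac{4(\alpha_2\gamma_0+\alpha_3)(s_0-1)^2}{\alpha_1T^2}+\frac{8\alpha_2}{\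alpha_1^2T}+\frac{2\alpha_3}{\alpha_1}.$$
   Context: Setting. There are $n$ workers and a central server; $b<n/2$ workers may be Byzantine. $\mathcal H\subset[n]=\{1,\dots,n\}$ is the set of honest workers, $|\mathcal H|=h=n-b$. Worker $i$ has data distribution $\mathcal D_i$ and, for a loss $\ell$, differentiable local objective $f_i(x)=\mathbb E_{\xi_i\sim\mathcal D_i}[\ell(x,\xi_i)]$, $x\in\mathbb R^d$. The global objective is $f_{\mathcal H}=\frac1h\sum_{i\in\mathcal H}f_i$, and $f_{\mathcal H}^*=\inf_{x\in\mathbb R^d}f_{\mathcal H}(x)>-\infty$. $\|\cdot\|$ is the Euclidean norm and $\mathbb E$ the total expectation. $\lfloor\cdot\rfloor$ is the floor function. R-DSGD (robust distributed SGD). Given a deterministic $x^0\in\mathbb R^d$, stepsizes $\gamma_t>0$ and an aggregation rule $\mathcal A:\mathbb R^{d\times n}\to\mathbb R^d$: for $t=1,2,\dots$, each honest worker $i\in\mathcal H$ sends a stochastic gradient $g_i^t=g_i(x^{t-1},\xi_i^t)$, where $\xi_i^t\sim\mathcal D_i$ is drawn afresh (independently of the past); each Byzantine worker $j$ sends an arbitrary vector $g_j^t\in\mathbb R^d$; the server sets $x^t=x^{t-1}-\gamma_t\,\mathcal A(g_1^t,\dots,g_n^t)$. $L$-smoothness: $f_{\mathcal H}$ is differentiable and $\nabla f_{\mathcal H}$ is Lipschitz continuous with constant $L>0$. PL condition with parameter $\mu>0$: $\|\nabla f_{\mathcal H}(x)\|^2\ge2\mu(f_{\mathcal H}(x)-f_{\mathcal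 H}^* )$ for all $x\in\mathbb R^d$. $(G,B)$-bounded dissimilarity ($G,B\ge0$): $\frac1h\sum_{i\in\mathcal H}\|\nabla f_i(x)-\nabla f_{\mathcal H}(x)\|^2\le G^2+B^2\|\nabla f_{\mathcal H}(x)\|^2$ for all $x\in\mathbb R^d$. Stochastic first-order oracle: for each $i\in\mathcal H$ and all $x$, $\mathbb E_{\xi_i\sim\mathcal D_i}[g_i(x,\xi_i)]=\nabla f_i(x)$ and $\mathbb E_{\xi_i\sim\mathcal D_i}[\|g_i(x,\xi_i)-\nabla f_i(x)\|^2]\le\sigma^2$; the stochastic gradients of different workers are mutually independent. $(b,\kappa)$-robustness ($\kappa>0$, $b<n/2$): for all $x_1,\dots,x_n\in\mathbb R^d$ and every $S\subset[n]$ with $|S|=n-b$, $\|\mathcal A(x_1,\dots,x_n)-\bar x_S\|^2\le\frac{\kappa}{n-b}\sum_{i\in S}\|x_i-\bar x_S\|^2$, where $\bar x_S=\frac1{n-b}\sum_{i\in S}x_i$. *)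

theory Defs
  imports "HOL-Probability.Probability"
begin

text \<open>
  Workers are the elements of a finite type \<open>'n\<close>, so the number of workers is \<open>CARD('n)\<close>; the
  parameter space is \<open>real ^ 'd\<close>, and an aggregation rule is a map \<open>(real ^ 'd) ^ 'n \<Rightarrow> real ^ 'd\<close>.
\<close>

definition gradient :: "(real ^ 'd \<Rightarrow> real) \<Rightarrow> real ^ 'd \<Rightarrow> real ^ 'd" where
  "gradient f x = (THE v. GDERIV f x :> v)"

lemma gradient_eqI: "GDERIV f x :> v \<Longrightarrow> gradient f x = v"
proof -
  assume v: "GDERIV f x :> v"
  have "w = v" if "GDERIV f x :> w" for w
  proof -
    have "(\<lambda>h. inner h w) = (\<lambda>h. inner h v)"
      using has_derivative_unique that v unfolding gderiv_def by blast
    then show "w = v"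
      by (metis inner_commute vector_eq_rdot)
  qed
  then show "gradient f x = v"
    unfolding gradient_def using v by blast
qed

definition local_objective ::
  "('n \<Rightarrow> 'z measure) \<Rightarrow> (real ^ 'd \<Rightarrow> 'z \<Rightarrow> real) \<Rightarrow> 'n \<Rightarrow> real ^ 'd \<Rightarrow> real" where
  "local_objective D loss i x = (\<integral>z. loss x z \<partial>D i)"

definition global_objective :: "'n set \<Rightarrow> ('n \<Rightarrow> real ^ 'd \<Rightarrow> real) \<Rightarrow> real ^ 'd \<Rightarrow> real" where
  "global_objective H f x = (\<Sum>i\<in>H. f i x) / real (card H)"

definition L_smooth :: "real \<Rightarrow> (real ^ 'd \<Rightarrow> real) \<Rightarrow> bool" where
  "L_smooth L f \<longleftrightarrow> L > 0 \<and> (\<forall>x. f differentiable (at x)) \<and> L-lipschitz_on UNIV (gradient f)"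

definition PL_condition :: "real \<Rightarrow> (real ^ 'd \<Rightarrow> real) \<Rightarrow> bool" where
  "PL_condition \<mu> f \<longleftrightarrow> \<mu> > 0 \<and>
     (\<forall>x. (norm (gradient f x))\<^sup>2 \<ge> 2 * \<mu> * (f x - Inf (range f)))"

definition bounded_dissimilarity ::
  "real \<Rightarrow> real \<Rightarrow> 'n set \<Rightarrow> ('n \<Rightarrow> real ^ 'd \<Rightarrow> real) \<Rightarrow> bool" where
  "bounded_dissimilarity G B H f \<longleftrightarrow> G \<ge> 0 \<and> B \<ge> 0 \<and>
     (\<forall>x. (\<Sum>i\<in>H. (norm (gradient (f i) x - gradient (global_objective H f) x))\<^sup>2) / real (card H)
          \<le> G\<^sup>2 + B\<^sup>2 * (norm (gradient (global_objective H f) x))\<^sup>2)"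

text \<open>
  The integrability conjuncts below are needed because the Bochner integral of a non-integrable
  function is \<open>0\<close>. Joint measurability of \<open>g i\<close> makes the stochastic gradient at a
  random point a random vector.
\<close>

definition stochastic_oracle ::
  "'n set \<Rightarrow> ('n \<Rightarrow> 'z measure) \<Rightarrow> ('n \<Rightarrow> real ^ 'd \<Rightarrow> real) \<Rightarrow>
   ('n \<Rightarrow> real ^ 'd \<Rightarrow> 'z \<Rightarrow> real ^ 'd) \<Rightarrow> real \<Rightarrow> bool" where
  "stochastic_oracle H D f g \<sigma> \<longleftrightarrow> (\<forall>i\<in>H.
     (\<lambda>(x, z). g i x z) \<in> borel_measurable (borel \<Otimes>\<^sub>M D i) \<and>
     (\<forall>x. integrable (D i) (g i x) \<and>
          (\<integral>z. g i x z \<partial>D i) = gradient (f i) x \<and>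
          integrable (D i) (\<lambda>z. (norm (g i x z - gradient (f i) x))\<^sup>2) \<and>
          (\<integral>z. (norm (g i x z - gradient (f i) x))\<^sup>2 \<partial>D i) \<le> \<sigma>\<^sup>2))"

text \<open>
  \<open>F t\<close> is the information available after round \<open>t\<close>; it may contain more than the honest
  samples, e.g. the randomness of the Byzantine workers. Samples are drawn in rounds
  \<open>1, 2, \<dots>\<close>. The joint honest sample of a round is independent of the past, and the
  stochastic gradients which the honest workers form from it at any given point are mutually
  independent.
\<close>

definition fresh_samples ::
  "'w measure \<Rightarrow> (nat \<Rightarrow> 'w measure) \<Rightarrow> 'n set \<Rightarrow> ('n \<Rightarrow> 'z measure) \<Rightarrow>
   ('n \<Rightarrow> real ^ 'd \<Rightarrow> 'z \<Rightarrow> real ^ 'd) \<Rightarrow> ('n \<Rightarrow> nat \<Rightarrow> 'w \<Rightarrow> 'z) \<Rightarrow> bool" where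
  "fresh_samples M F H D g \<xi> \<longleftrightarrow>
     filtration (space M) F \<and> (\<forall>t. subalgebra M (F t)) \<and>
     (\<forall>t. (\<forall>i\<in>H. \<xi> i (Suc t) \<in> measurable (F (Suc t)) (D i) \<and>
                  distr M (D i) (\<xi> i (Suc t)) = D i) \<and>
          prob_space.indep_set M (sets (F t))
            (sets (vimage_algebra (space M) (\<lambda>w. \<lambda>i\<in>H. \<xi> i (Suc t) w) (PiM H D))) \<and>
          (\<forall>x. prob_space.indep_vars M (\<lambda>_. borel) (\<lambda>i w. g i x (\<xi> i (Suc t) w)) H))"

definition robust_aggregation :: "nat \<Rightarrow> real \<Rightarrow> ((real ^ 'd) ^ 'n \<Rightarrow> real ^ 'd) \<Rightarrow> bool" where
  "robust_aggregation b \<kappa> A \<longleftrightarrow> \<kappa> > 0 \<and> 2 * b < CARD('n) \<and>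
     (\<forall>(x :: (real ^ 'd) ^ 'n) S. card S = CARD('n) - b \<longrightarrow>
        (let m = (1 / real (CARD('n) - b)) *\<^sub>R (\<Sum>i\<in>S. x $ i)
         in (norm (A x - m))\<^sup>2 \<le> \<kappa> / real (CARD('n) - b) * (\<Sum>i\<in>S. (norm (x $ i - m))\<^sup>2)))"

text \<open>
  One realization of R-DSGD: \<open>z i t\<close> is the sample of worker \<open>i\<close> and \<open>v i t\<close> the vector sent by
  worker \<open>i\<close> in round \<open>t\<close> if \<open>i\<close> is Byzantine.
\<close>

primrec rdsgd ::
  "'n set \<Rightarrow> ((real ^ 'd) ^ 'n \<Rightarrow> real ^ 'd) \<Rightarrow> ('n \<Rightarrow> real ^ 'd \<Rightarrow> 'z \<Rightarrow> real ^ 'd) \<Rightarrow>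
   (nat \<Rightarrow> real) \<Rightarrow> real ^ 'd \<Rightarrow> ('n \<Rightarrow> nat \<Rightarrow> 'z) \<Rightarrow> ('n \<Rightarrow> nat \<Rightarrow> real ^ 'd) \<Rightarrow>
   nat \<Rightarrow> real ^ 'd" where
  "rdsgd H A g \<gamma> x0 z v 0 = x0"
| "rdsgd H A g \<gamma> x0 z v (Suc t) =
     rdsgd H A g \<gamma> x0 z v t - \<gamma> (Suc t) *\<^sub>R
       A (\<chi> i. if i \<in> H then g i (rdsgd H A g \<gamma> x0 z v t) (z i (Suc t)) else v i (Suc t))"

text \<open>
  Expectations of the iterates make sense, and fresh samples are fresh for the iterates, once
  the iterates are adapted to \<open>F\<close>. No regularity of the aggregation rule or of the Byzantine
  vectors is needed beyond that; the lemma shows that it suffices that the former is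
  Borel and the latter are adapted.
\<close>

lemma borel_measurable_vec_lambda:
  fixes h :: "'n::finite \<Rightarrow> 'w \<Rightarrow> real ^ 'd"
  assumes "\<And>i. h i \<in> borel_measurable N"
  shows "(\<lambda>w. \<chi> i. h i w) \<in> borel_measurable N"
proof -
  have "(\<lambda>w. \<chi> i. h i w) = (\<lambda>w. \<Sum>i\<in>UNIV. axis i (h i w))"
    by (simp add: fun_eq_iff vec_eq_iff axis_def if_distrib cong: if_cong)
  moreover have "(\<lambda>w. axis i (h i w) :: (real ^ 'd) ^ 'n) \<in> borel_measurable N" for i
  proof (rule borel_measurable_continuous_on[OF _ assms])
    have "linear (\<lambda>y. axis i y :: (real ^ 'd) ^ 'n)"
      by (rule linearI) (simp_all add: vec_eq_iff axis_def)
    then show "continuous_on UNIV (\<lambda>y. axis i y :: (real ^ 'd) ^ 'n)"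
      by (rule linear_continuous_on[OF linear_conv_bounded_linear[THEN iffD1]])
  qed
  ultimately show ?thesis
    by simp
qed

lemma rdsgd_adapted:
  assumes F: "fresh_samples M F H D g \<xi>" and g: "stochastic_oracle H D f g \<sigma>"
    and A: "A \<in> borel_measurable borel"
    and v: "\<And>i t. v i (Suc t) \<in> borel_measurable (F (Suc t))"
  shows "(\<lambda>w. rdsgd H A g \<gamma> x0 (\<lambda>i t. \<xi> i t w) (\<lambda>i t. v i t w) t) \<in> borel_measurable (F t)"
proof (induction t)
  case 0
  show ?case by simp
next
  case (Suc t)
  let ?X = "\<lambda>w. rdsgd H A g \<gamma> x0 (\<lambda>i t. \<xi> i t w) (\<lambda>i t. v i t w) t"
  have "filtration (space M) F"
    using F by (simp add: fresh_samples_def)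
  then have "subalgebra (F (Suc t)) (F t)"
    by (simp add: filtration_def subalgebra_def)
  then have X: "?X \<in> borel_measurable (F (Suc t))"
    using Suc.IH by (rule measurable_from_subalg)
  have "(\<lambda>w. if i \<in> H then g i (?X w) (\<xi> i (Suc t) w) else v i (Suc t) w)
          \<in> borel_measurable (F (Suc t))" for i
  proof (cases "i \<in> H")
    case True
    then have "\<xi> i (Suc t) \<in> measurable (F (Suc t)) (D i)"
      and gi: "(\<lambda>(x, z). g i x z) \<in> borel_measurable (borel \<Otimes>\<^sub>M D i)"
      using F g by (auto simp: fresh_samples_def stochastic_oracle_def)
    then have "(\<lambda>w. (?X w, \<xi> i (Suc t) w)) \<in> measurable (F (Suc t)) (borel \<Otimes>\<^sub>M D i)"
      using X by simp
    from measurable_compose[OF this gi] True show ?thesis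
      by simp
  qed (use v in simp)
  from measurable_compose[OF borel_measurable_vec_lambda[OF this] A] X show ?case
    by simp
qed

end

theory Submission
  imports Defs
begin

text \<open>
  Write \<open>m\<close> for the mean of the honest stochastic gradients of a round, \<open>v\<close> for the
  gradient of \<open>fH\<close> at the current iterate and \<open>A = m + e\<close> for the aggregate. Smoothness gives
  \<open>fH (x - \<gamma> A) \<le> fH x - \<gamma> v \<bullet> A + L \<gamma>\<^sup>2 / 2 \<parallel>A\<parallel>\<^sup>2\<close>, and robustness bounds \<open>\<parallel>e\<parallel>\<^sup>2\<close> by
  \<open>\<kappa>\<close> times the empirical variance of the honest vectors, whatever the Byzantine workers send.
  Hence the new value is at most a \<open>step_majorant\<close> that depends on the honest gradients only
  (\<open>step_majorant_upper_bound\<close>).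

  The expectation of the majorant at a fixed point \<open>x\<close> is computed from three facts: the mean
  \<open>m\<close> is unbiased, its variance is at most \<open>\<sigma>\<^sup>2 / h\<close> because independent centered vectors
  are orthogonal in \<open>L\<^sup>2\<close>, and the empirical variance is at most \<open>G\<^sup>2 + B\<^sup>2 \<parallel>v\<parallel>\<^sup>2 + \<sigma>\<^sup>2\<close>
  by bounded dissimilarity (\<open>expectation_step_majorant_le\<close>). Since the samples of a round
  are independent of the past, the fixed point may be replaced by the current iterate
  (\<open>nn_integral_fresh\<close>). The majorant minus the infimum of \<open>fH\<close> is nonnegative, so this is
  an application of Tonelli's theorem, which also yields the integrability of the next value. As
  \<open>L \<gamma> \<le> \<delta>\<close>, the PL condition turns the remaining
  multiple of \<open>- \<parallel>v\<parallel>\<^sup>2\<close> into a contraction (\<open>PL_contraction\<close>), and the expected gap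
  \<open>a t\<close> satisfies (\<open>rdsgd_one_step\<close>)
  \<open>a (t + 1) \<le> (1 - \<alpha>1 \<gamma>) a t + \<alpha>2 \<gamma>\<^sup>2 + \<alpha>3 \<gamma>\<close>, where \<open>\<gamma>\<close> is the stepsize of round
  \<open>t + 1\<close>.

  What is left concerns real sequences (\<open>two_phase_stepsize_bound\<close>). The constant stepsizes
  contract \<open>a 0\<close> geometrically, up to the fixed point \<open>(\<alpha>2 \<gamma>0 + \<alpha>3) / \<alpha>1\<close>. For
  \<open>\<gamma> = 2 / (\<alpha>1 s)\<close> the factor is \<open>1 - 2 / s\<close>, and \<open>s\<^sup>2 (1 - 2 / s) \<le> (s - 1)\<^sup>2\<close> makes
  \<open>s\<^sup>2 a\<close> telescope; the last \<open>s\<close> is at least \<open>T / 2\<close>.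
\<close>

section \<open>Gradients and smoothness\<close>

lemma GDERIV_gradient:
  assumes "f differentiable (at x)"
  shows "GDERIV f x :> gradient f x"
proof -
  obtain f' where f': "(f has_derivative f') (at x)"
    using assms by (auto simp: differentiable_def)
  then have "linear f'"
    by (rule has_derivative_linear)
  then have "f' = (\<lambda>h. h \<bullet> adjoint f' 1)"
    using adjoint_works[of f'] by (auto simp: fun_eq_iff inner_commute)
  with f' have "GDERIV f x :> adjoint f' 1"
    by (simp add: gderiv_def)
  then show ?thesis
    using gradient_eqI by metis
qed

lemma gradient_global_objective:
  assumes "finite H" and f: "\<And>i. i \<in> H \<Longrightarrow> f i differentiable (at x)"
  shows "gradient (global_objective H f) x = (1 / real (card H)) *\<^sub>R (\<Sum>i\<in>H. gradient (f i) x)"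
proof (rule gradient_eqI)
  have "((\<lambda>y. (1 / real (card H)) *\<^sub>R (\<Sum>i\<in>H. f i y)) has_derivative
      (\<lambda>h. (1 / real (card H)) *\<^sub>R (\<Sum>i\<in>H. h \<bullet> gradient (f i) x))) (at x)"
    using GDERIV_gradient[OF f] unfolding gderiv_def
    by (intro has_derivative_scaleR_right has_derivative_sum)
  then show "GDERIV (global_objective H f) x :> (1 / real (card H)) *\<^sub>R (\<Sum>i\<in>H. gradient (f i) x)"
    by (simp add: gderiv_def global_objective_def[abs_def] inner_sum_right inner_sum_left)
qed

text \<open>
  Along the segment from \<open>x\<close> to \<open>x + d\<close> the difference of the two sides has a derivative of
  constant sign, by the Lipschitz bound on the gradient.
\<close>

lemma L_smooth_upper_bound:
  fixes f :: "real ^ 'd \<Rightarrow> real"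
  assumes "L_smooth L f"
  shows "f (x + d) \<le> f x + gradient f x \<bullet> d + L / 2 * (norm d)\<^sup>2"
proof -
  have diff: "\<And>y. f differentiable (at y)" and lip: "L-lipschitz_on UNIV (gradient f)"
    using assms by (auto simp: L_smooth_def)
  define \<phi> where "\<phi> t = f (x + t *\<^sub>R d) - t * (gradient f x \<bullet> d) - L / 2 * (norm d)\<^sup>2 * t\<^sup>2" for t
  have "\<phi> 1 \<le> \<phi> 0"
  proof (rule DERIV_nonpos_imp_nonincreasing[where f = \<phi> and a = 0 and b = 1])
    fix t :: real assume t: "0 \<le> t" "t \<le> 1"
    let ?D = "d \<bullet> gradient f (x + t *\<^sub>R d) - gradient f x \<bullet> d - L * (norm d)\<^sup>2 * t"
    have "((\<lambda>t. f (x + t *\<^sub>R d)) has_derivative (\<lambda>h. (h *\<^sub>R d) \<bullet> gradient f (x + t *\<^sub>R d))) (at t)"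
      by (rule has_derivative_compose[OF _ GDERIV_gradient[OF diff, unfolded gderiv_def]])
        (auto intro!: derivative_eq_intros)
    then have "((\<lambda>t. f (x + t *\<^sub>R d)) has_real_derivative d \<bullet> gradient f (x + t *\<^sub>R d)) (at t)"
      unfolding has_field_derivative_def by (rule has_derivative_eq_rhs) (simp add: fun_eq_iff)
    then have "(\<phi> has_real_derivative ?D) (at t)"
      unfolding \<phi>_def by (auto intro!: derivative_eq_intros)
    moreover have "?D \<le> 0"
    proof -
      have "d \<bullet> gradient f (x + t *\<^sub>R d) - gradient f x \<bullet> d
          = (gradient f (x + t *\<^sub>R d) - gradient f x) \<bullet> d"
        by (simp add: inner_diff_left inner_diff_right inner_commute)
      also have "\<dots> \<le> norm (gradient f (x + t *\<^sub>R d) - gradient f x) * norm d"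
        by (rule norm_cauchy_schwarz)
      also have "\<dots> \<le> (L * (t * norm d)) * norm d"
        using lipschitz_onD[OF lip, of "x + t *\<^sub>R d" x] t
        by (intro mult_right_mono) (auto simp: dist_norm)
      finally show ?thesis
        by (simp add: power2_eq_square mult_ac)
    qed
    ultimately show "\<exists>y. (\<phi> has_real_derivative y) (at t) \<and> y \<le> 0"
      by blast
  qed simp
  then show ?thesis
    by (simp add: \<phi>_def)
qed

lemma borel_measurable_L_smooth:
  assumes "L_smooth L f"
  shows "f \<in> borel_measurable borel" and "gradient f \<in> borel_measurable borel"
proof -
  show "f \<in> borel_measurable borel"
    using assms unfolding L_smooth_def
    by (intro borel_measurable_continuous_onI differentiable_imp_continuous_on)
      (simp add: differentiable_on_eq_differentiable_at)
  show "gradient f \<in> borel_measurable borel"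
    using assms unfolding L_smooth_def
    by (intro borel_measurable_continuous_onI lipschitz_on_continuous_on) auto
qed

section \<open>A bound on one step that is free of the Byzantine vectors\<close>

text \<open>
  The mean minimizes the sum of squared distances. Robustness measures the honest vectors from
  their empirical mean, whereas the assumptions on the oracle and on dissimilarity concern
  deviations from gradients.
\<close>

lemma sum_sq_dist_mean_le:
  fixes u :: "'i \<Rightarrow> 'a::real_inner"
  assumes "finite S" "S \<noteq> {}" and m: "m = (1 / real (card S)) *\<^sub>R (\<Sum>i\<in>S. u i)"
  shows "(\<Sum>i\<in>S. (norm (u i - m))\<^sup>2) \<le> (\<Sum>i\<in>S. (norm (u i - c))\<^sup>2)"
proof -
  have "(\<Sum>i\<in>S. u i) = real (card S) *\<^sub>R m"
    using assms by simp
  then have 0: "(\<Sum>i\<in>S. u i - m) = 0"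
    by (simp add: sum_subtractf scaleR_left.sum sum_constant_scaleR)
  have "(norm (u i - c))\<^sup>2 = (norm (u i - m))\<^sup>2 + 2 * ((u i - m) \<bullet> (m - c)) + (norm (m - c))\<^sup>2" for i
    unfolding power2_norm_eq_inner by (simp add: algebra_simps inner_commute)
  then have "(\<Sum>i\<in>S. (norm (u i - c))\<^sup>2) = (\<Sum>i\<in>S. (norm (u i - m))\<^sup>2)
      + 2 * ((\<Sum>i\<in>S. u i - m) \<bullet> (m - c)) + real (card S) * (norm (m - c))\<^sup>2"
    by (simp add: sum.distrib sum_distrib_left inner_sum_left)
  then show ?thesis
    unfolding 0 by simp
qed

text \<open>
  Here \<open>c\<close> and \<open>v\<close> stand for the value and the gradient of the objective at the current
  point and \<open>u\<close> for the honest vectors. The inner product with \<open>m\<close> is kept as it is,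
  since it is the term whose expectation is exact.
\<close>

definition step_majorant ::
  "real \<Rightarrow> real \<Rightarrow> real \<Rightarrow> 'n set \<Rightarrow> real \<Rightarrow> 'a \<Rightarrow> ('n \<Rightarrow> 'a::real_inner) \<Rightarrow> real" where
  "step_majorant L \<kappa> \<gamma> H c v u =
     (let m = (1 / real (card H)) *\<^sub>R (\<Sum>i\<in>H. u i)
      in c - \<gamma> * (v \<bullet> m) + \<gamma> / 2 * (norm v)\<^sup>2 + L * \<gamma>\<^sup>2 * (norm m)\<^sup>2
         + (\<gamma> / 2 + L * \<gamma>\<^sup>2) * \<kappa> * ((\<Sum>i\<in>H. (norm (u i - v))\<^sup>2) / real (card H)))"

text \<open>
  With \<open>A y = m + e\<close>, Young's inequality separates the error: \<open>- v \<bullet> e \<le> (\<parallel>v\<parallel>\<^sup>2 + \<parallel>e\<parallel>\<^sup>2) / 2\<close> and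
  \<open>\<parallel>m + e\<parallel>\<^sup>2 \<le> 2 \<parallel>m\<parallel>\<^sup>2 + 2 \<parallel>e\<parallel>\<^sup>2\<close>. Robustness for the honest set then bounds \<open>\<parallel>e\<parallel>\<^sup>2\<close>.
\<close>

lemma step_majorant_upper_bound:
  fixes A :: "(real ^ 'd) ^ 'n::finite \<Rightarrow> real ^ 'd"
  assumes smooth: "L_smooth L f" and robust: "robust_aggregation b \<kappa> A"
    and card: "card H = CARD('n) - b" and \<gamma>: "\<gamma> \<ge> 0" and u: "\<And>i. i \<in> H \<Longrightarrow> y $ i = u i"
  shows "f (x - \<gamma> *\<^sub>R A y) \<le> step_majorant L \<kappa> \<gamma> H (f x) (gradient f x) u"
proof -
  define v where "v = gradient f x"
  define m where "m = (1 / real (card H)) *\<^sub>R (\<Sum>i\<in>H. u i)"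
  define e where "e = A y - m"
  define V where "V = (\<Sum>i\<in>H. (norm (u i - v))\<^sup>2) / real (card H)"
  have L: "L > 0" and \<kappa>: "\<kappa> > 0" and b: "2 * b < CARD('n)"
    using smooth robust by (auto simp: L_smooth_def robust_aggregation_def)
  have H: "H \<noteq> {}"
    using card b by auto
  have m': "(1 / real (CARD('n) - b)) *\<^sub>R (\<Sum>i\<in>H. y $ i) = m"
    by (simp add: m_def card u)
  have s': "(\<Sum>i\<in>H. (norm (y $ i - m))\<^sup>2) = (\<Sum>i\<in>H. (norm (u i - m))\<^sup>2)"
    by (simp add: u)
  have "(norm e)\<^sup>2 \<le> \<kappa> / real (card H) * (\<Sum>i\<in>H. (norm (u i - m))\<^sup>2)"
    using robust card unfolding robust_aggregation_def Let_def e_def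
    by (metis m' s')
  also have "\<dots> \<le> \<kappa> / real (card H) * (\<Sum>i\<in>H. (norm (u i - v))\<^sup>2)"
    using \<kappa> H by (intro mult_left_mono sum_sq_dist_mean_le) (auto simp: m_def)
  finally have e: "(norm e)\<^sup>2 \<le> \<kappa> * V"
    by (simp add: V_def)
  have "f (x - \<gamma> *\<^sub>R A y) \<le> f x - \<gamma> * (v \<bullet> (m + e)) + L / 2 * \<gamma>\<^sup>2 * (norm (m + e))\<^sup>2"
    using L_smooth_upper_bound[OF smooth, of x "- \<gamma> *\<^sub>R A y"]
    by (simp add: v_def e_def power_mult_distrib)
  also have "\<dots> \<le> f x - \<gamma> * (v \<bullet> m - (norm v)\<^sup>2 / 2 - (norm e)\<^sup>2 / 2)
        + L / 2 * \<gamma>\<^sup>2 * (2 * (norm m)\<^sup>2 + 2 * (norm e)\<^sup>2)"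
  proof -
    have "0 \<le> (norm (v + e))\<^sup>2" "0 \<le> (norm (m - e))\<^sup>2"
      by simp_all
    then have "v \<bullet> (m + e) \<ge> v \<bullet> m - (norm v)\<^sup>2 / 2 - (norm e)\<^sup>2 / 2"
      and "(norm (m + e))\<^sup>2 \<le> 2 * (norm m)\<^sup>2 + 2 * (norm e)\<^sup>2"
      unfolding power2_norm_eq_inner by (simp_all add: algebra_simps inner_commute)
    with \<gamma> L show ?thesis
      by (intro add_mono diff_mono mult_left_mono) auto
  qed
  also have "\<dots> = f x - \<gamma> * (v \<bullet> m) + \<gamma> / 2 * (norm v)\<^sup>2 + L * \<gamma>\<^sup>2 * (norm m)\<^sup>2
        + (\<gamma> / 2 + L * \<gamma>\<^sup>2) * (norm e)\<^sup>2"
    by (simp add: field_simps)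
  also have "\<dots> \<le> f x - \<gamma> * (v \<bullet> m) + \<gamma> / 2 * (norm v)\<^sup>2 + L * \<gamma>\<^sup>2 * (norm m)\<^sup>2
        + (\<gamma> / 2 + L * \<gamma>\<^sup>2) * (\<kappa> * V)"
    using e \<gamma> L by (intro add_left_mono mult_left_mono) auto
  finally show ?thesis
    by (simp add: step_majorant_def Let_def v_def m_def V_def mult_ac)
qed

section \<open>The expected bound at a fixed point\<close>

text \<open>
  Independence of vectors passes to their coordinates, where the expectation of a product is the
  product of the expectations.
\<close>

lemma (in prob_space) indep_zero_mean_inner:
  fixes Y :: "'i \<Rightarrow> 'a \<Rightarrow> 'b::euclidean_space"
  assumes indep: "indep_vars (\<lambda>_. borel) Y I" and ij: "i \<in> I" "j \<in> I" "i \<noteq> j"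
    and int: "integrable M (Y i)" "integrable M (Y j)" and mean: "expectation (Y i) = 0"
  shows "integrable M (\<lambda>w. Y i w \<bullet> Y j w)" and "expectation (\<lambda>w. Y i w \<bullet> Y j w) = 0"
proof -
  have *: "integrable M (\<lambda>w. (Y i w \<bullet> e) * (Y j w \<bullet> e))"
    "expectation (\<lambda>w. (Y i w \<bullet> e) * (Y j w \<bullet> e)) = 0" for e
  proof -
    have "indep_vars (\<lambda>_. borel) (\<lambda>k w. Y k w \<bullet> e) {i, j}"
      using indep_vars_subset[OF indep, of "{i, j}"] ij
      by (intro indep_vars_compose2[where Y = "\<lambda>_ y. y \<bullet> e"]) auto
    moreover have "integrable M (\<lambda>w. Y k w \<bullet> e)" if "k \<in> {i, j}" for k
      using int that by auto
    ultimately have "integrable M (\<lambda>w. \<Prod>k\<in>{i, j}. Y k w \<bullet> e)"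
      "(\<integral>w. (\<Prod>k\<in>{i, j}. Y k w \<bullet> e) \<partial>M) = (\<Prod>k\<in>{i, j}. \<integral>w. Y k w \<bullet> e \<partial>M)"
      by (intro indep_vars_integrable indep_vars_lebesgue_integral; simp)+
    then show "integrable M (\<lambda>w. (Y i w \<bullet> e) * (Y j w \<bullet> e))"
      "expectation (\<lambda>w. (Y i w \<bullet> e) * (Y j w \<bullet> e)) = 0"
      using ij int mean by simp_all
  qed
  have eq: "Y i w \<bullet> Y j w = (\<Sum>e\<in>Basis. (Y i w \<bullet> e) * (Y j w \<bullet> e))" for w
    by (rule euclidean_inner)
  show "integrable M (\<lambda>w. Y i w \<bullet> Y j w)" "expectation (\<lambda>w. Y i w \<bullet> Y j w) = 0"
    unfolding eq using * by simp_all
qed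

lemma (in prob_space) indep_zero_mean_norm_sum_sq:
  fixes Y :: "'i \<Rightarrow> 'a \<Rightarrow> 'b::euclidean_space"
  assumes "finite I" and indep: "indep_vars (\<lambda>_. borel) Y I"
    and int: "\<And>i. i \<in> I \<Longrightarrow> integrable M (Y i)" and mean: "\<And>i. i \<in> I \<Longrightarrow> expectation (Y i) = 0"
    and sq: "\<And>i. i \<in> I \<Longrightarrow> integrable M (\<lambda>w. (norm (Y i w))\<^sup>2)"
  shows "integrable M (\<lambda>w. (norm (\<Sum>i\<in>I. Y i w))\<^sup>2)"
    and "expectation (\<lambda>w. (norm (\<Sum>i\<in>I. Y i w))\<^sup>2) = (\<Sum>i\<in>I. expectation (\<lambda>w. (norm (Y i w))\<^sup>2))"
proof -
  have eq: "(norm (\<Sum>i\<in>I. Y i w))\<^sup>2 = (\<Sum>i\<in>I. \<Sum>j\<in>I. Y i w \<bullet> Y j w)" for w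
    unfolding power2_norm_eq_inner inner_sum_left unfolding inner_sum_right ..
  have 1: "integrable M (\<lambda>w. Y i w \<bullet> Y j w)" if "i \<in> I" "j \<in> I" for i j
    using that sq[of i] indep_zero_mean_inner(1)[OF indep, of i j] int mean
    by (cases "i = j") (auto simp: power2_norm_eq_inner)
  have 2: "expectation (\<lambda>w. Y i w \<bullet> Y j w) = (if i = j then expectation (\<lambda>w. (norm (Y i w))\<^sup>2) else 0)"
    if "i \<in> I" "j \<in> I" for i j
    using that indep_zero_mean_inner(2)[OF indep, of i j] int mean
    by (auto simp: power2_norm_eq_inner)
  show "integrable M (\<lambda>w. (norm (\<Sum>i\<in>I. Y i w))\<^sup>2)"
    unfolding eq using 1 by (intro Bochner_Integration.integrable_sum) auto
  have "expectation (\<lambda>w. (norm (\<Sum>i\<in>I. Y i w))\<^sup>2)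
      = (\<Sum>i\<in>I. \<Sum>j\<in>I. expectation (\<lambda>w. Y i w \<bullet> Y j w))"
    unfolding eq using 1 by (simp add: Bochner_Integration.integral_sum Bochner_Integration.integrable_sum)
  also have "\<dots> = (\<Sum>i\<in>I. expectation (\<lambda>w. (norm (Y i w))\<^sup>2))"
    using \<open>finite I\<close> by (simp add: 2 sum.delta)
  finally show "expectation (\<lambda>w. (norm (\<Sum>i\<in>I. Y i w))\<^sup>2)
      = (\<Sum>i\<in>I. expectation (\<lambda>w. (norm (Y i w))\<^sup>2))" .
qed

lemma (in prob_space) sq_dist_bias_variance:
  fixes U :: "'a \<Rightarrow> 'b::euclidean_space"
  assumes int: "integrable M U" and sq: "integrable M (\<lambda>w. (norm (U w - expectation U))\<^sup>2)"
  shows "integrable M (\<lambda>w. (norm (U w - c))\<^sup>2)"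
    and "expectation (\<lambda>w. (norm (U w - c))\<^sup>2)
      = (norm (expectation U - c))\<^sup>2 + expectation (\<lambda>w. (norm (U w - expectation U))\<^sup>2)"
proof -
  let ?m = "expectation U"
  have eq: "(norm (U w - c))\<^sup>2 = (norm (U w - ?m))\<^sup>2 + 2 * ((U w - ?m) \<bullet> (?m - c)) + (norm (?m - c))\<^sup>2" for w
    unfolding power2_norm_eq_inner by (simp add: algebra_simps inner_commute)
  have i: "integrable M (\<lambda>w. (U w - ?m) \<bullet> (?m - c))"
    using int by simp
  have z: "expectation (\<lambda>w. (U w - ?m) \<bullet> (?m - c)) = 0"
    using int by (simp add: prob_space)
  show "integrable M (\<lambda>w. (norm (U w - c))\<^sup>2)"
    unfolding eq using sq i by simp
  show "expectation (\<lambda>w. (norm (U w - c))\<^sup>2)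
      = (norm (?m - c))\<^sup>2 + expectation (\<lambda>w. (norm (U w - ?m))\<^sup>2)"
    unfolding eq using sq i z by (simp add: prob_space)
qed

text \<open>
  The vectors \<open>u i\<close> have means \<open>q i\<close> which average to \<open>v\<close>. Averaging \<open>card H\<close> independent
  vectors divides the variance by \<open>card H\<close>, while the distance of a single \<open>u i\<close> from \<open>v\<close>
  keeps its own variance in addition to the bias \<open>q i - v\<close>.
\<close>

lemma (in prob_space) expectation_step_majorant_le:
  fixes u :: "'n \<Rightarrow> 'a \<Rightarrow> 'b::euclidean_space"
  assumes H: "finite H" "H \<noteq> {}" and indep: "indep_vars (\<lambda>_. borel) u H"
    and int: "\<And>i. i \<in> H \<Longrightarrow> integrable M (u i)" and mean: "\<And>i. i \<in> H \<Longrightarrow> expectation (u i) = q i"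
    and sq: "\<And>i. i \<in> H \<Longrightarrow> integrable M (\<lambda>w. (norm (u i w - q i))\<^sup>2)"
    and var: "\<And>i. i \<in> H \<Longrightarrow> expectation (\<lambda>w. (norm (u i w - q i))\<^sup>2) \<le> s"
    and v: "v = (1 / real (card H)) *\<^sub>R (\<Sum>i\<in>H. q i)"
    and dissim: "(\<Sum>i\<in>H. (norm (q i - v))\<^sup>2) / real (card H) \<le> V"
    and nn: "L \<ge> 0" "\<kappa> \<ge> 0" "\<gamma> \<ge> 0"
  shows "integrable M (\<lambda>w. step_majorant L \<kappa> \<gamma> H c v (\<lambda>i. u i w))"
    and "expectation (\<lambda>w. step_majorant L \<kappa> \<gamma> H c v (\<lambda>i. u i w))
      \<le> c - \<gamma> / 2 * (norm v)\<^sup>2 + L * \<gamma>\<^sup>2 * ((norm v)\<^sup>2 + s / real (card H))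
         + (\<gamma> / 2 + L * \<gamma>\<^sup>2) * \<kappa> * (V + s)"
proof -
  define h where "h = real (card H)"
  have h: "h > 0"
    using H by (simp add: h_def card_gt_0_iff)
  define m where "m w = (1 / h) *\<^sub>R (\<Sum>i\<in>H. u i w)" for w
  define W where "W w = (\<Sum>i\<in>H. (norm (u i w - v))\<^sup>2) / h" for w
  have intm: "integrable M m" and meanm: "expectation m = v"
    unfolding m_def v using int mean by (auto simp: Bochner_Integration.integral_sum h_def)
  have indep': "indep_vars (\<lambda>_. borel) (\<lambda>i w. u i w - q i) H"
    by (rule indep_vars_compose2[OF indep, where Y = "\<lambda>i y. y - q i"]) simp
  have int': "integrable M (\<lambda>w. u i w - q i)" "expectation (\<lambda>w. u i w - q i) = 0" if "i \<in> H" for i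
    using int[OF that] mean[OF that] by (simp_all add: prob_space)
  note uncorr = indep_zero_mean_norm_sum_sq[OF H(1) indep' int' sq]
  have dev: "(norm (m w - v))\<^sup>2 = (norm (\<Sum>i\<in>H. u i w - q i))\<^sup>2 / h\<^sup>2" for w
  proof -
    have "m w - v = (1 / h) *\<^sub>R (\<Sum>i\<in>H. u i w - q i)"
      by (simp add: m_def v h_def sum_subtractf scaleR_diff_right)
    then show ?thesis
      using h by (simp add: power_divide)
  qed
  have sqm': "integrable M (\<lambda>w. (norm (m w - expectation m))\<^sup>2)"
    unfolding meanm dev using uncorr(1) by simp
  have "expectation (\<lambda>w. (norm (m w - v))\<^sup>2)
      = (\<Sum>i\<in>H. expectation (\<lambda>w. (norm (u i w - q i))\<^sup>2)) / h\<^sup>2"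
    unfolding dev using uncorr(2) by simp
  also have "\<dots> \<le> (h * s) / h\<^sup>2"
    using sum_bounded_above[of H _ s, OF var] by (intro divide_right_mono) (auto simp: h_def)
  finally have varm: "expectation (\<lambda>w. (norm (m w - v))\<^sup>2) \<le> s / h"
    using h by (simp add: power2_eq_square)
  have sqm: "integrable M (\<lambda>w. (norm (m w))\<^sup>2)"
    and Em: "expectation (\<lambda>w. (norm (m w))\<^sup>2) \<le> (norm v)\<^sup>2 + s / h"
    using sq_dist_bias_variance[OF intm sqm', of 0] varm meanm by simp_all
  have bv: "integrable M (\<lambda>w. (norm (u i w - v))\<^sup>2)"
    "expectation (\<lambda>w. (norm (u i w - v))\<^sup>2) \<le> (norm (q i - v))\<^sup>2 + s" if "i \<in> H" for i
    using sq_dist_bias_variance[OF int[OF that], of v] sq[OF that] var[OF that] mean[OF that]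
    by simp_all
  have intW: "integrable M W"
    unfolding W_def using bv(1) by (intro integrable_divide_zero Bochner_Integration.integrable_sum) auto
  have "expectation W = (\<Sum>i\<in>H. expectation (\<lambda>w. (norm (u i w - v))\<^sup>2)) / h"
    unfolding W_def using bv(1) by (simp add: Bochner_Integration.integral_sum)
  also have "\<dots> \<le> (\<Sum>i\<in>H. (norm (q i - v))\<^sup>2 + s) / h"
    using h bv(2) by (intro divide_right_mono sum_mono) auto
  also have "\<dots> \<le> V + s"
    using dissim h by (simp add: sum.distrib add_divide_distrib h_def[symmetric])
  finally have EW: "expectation W \<le> V + s" .
  have eq: "step_majorant L \<kappa> \<gamma> H c v (\<lambda>i. u i w)
      = c - \<gamma> * (v \<bullet> m w) + \<gamma> / 2 * (norm v)\<^sup>2 + L * \<gamma>\<^sup>2 * (norm (m w))\<^sup>2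
         + (\<gamma> / 2 + L * \<gamma>\<^sup>2) * \<kappa> * W w" for w
    by (simp add: step_majorant_def Let_def m_def W_def h_def)
  have ints: "integrable M (\<lambda>w. \<gamma> * (v \<bullet> m w))" "integrable M (\<lambda>w. L * \<gamma>\<^sup>2 * (norm (m w))\<^sup>2)"
    "integrable M (\<lambda>w. (\<gamma> / 2 + L * \<gamma>\<^sup>2) * \<kappa> * W w)"
    using intm sqm intW by (auto intro!: integrable_mult_right integrable_inner_right)
  show "integrable M (\<lambda>w. step_majorant L \<kappa> \<gamma> H c v (\<lambda>i. u i w))"
    unfolding eq using ints by (intro Bochner_Integration.integrable_add Bochner_Integration.integrable_diff) auto
  have "expectation (\<lambda>w. step_majorant L \<kappa> \<gamma> H c v (\<lambda>i. u i w))
      = c - \<gamma> * (v \<bullet> v) + \<gamma> / 2 * (norm v)\<^sup>2 + L * \<gamma>\<^sup>2 * expectation (\<lambda>w. (norm (m w))\<^sup>2)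
         + (\<gamma> / 2 + L * \<gamma>\<^sup>2) * \<kappa> * expectation W"
    unfolding eq using ints intm meanm by (simp add: prob_space)
  also have "\<dots> \<le> c - \<gamma> * (v \<bullet> v) + \<gamma> / 2 * (norm v)\<^sup>2 + L * \<gamma>\<^sup>2 * ((norm v)\<^sup>2 + s / h)
         + (\<gamma> / 2 + L * \<gamma>\<^sup>2) * \<kappa> * (V + s)"
    using nn Em EW by (intro add_mono mult_left_mono) auto
  finally show "expectation (\<lambda>w. step_majorant L \<kappa> \<gamma> H c v (\<lambda>i. u i w))
      \<le> c - \<gamma> / 2 * (norm v)\<^sup>2 + L * \<gamma>\<^sup>2 * ((norm v)\<^sup>2 + s / real (card H))
         + (\<gamma> / 2 + L * \<gamma>\<^sup>2) * \<kappa> * (V + s)"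
    by (simp add: power2_norm_eq_inner h_def)
qed

section \<open>Fresh samples\<close>

text \<open>
  A form of conditioning on \<open>G\<close>: the joint law of \<open>X\<close> and \<open>Z\<close> is the product of the two
  laws, so Tonelli's theorem integrates \<open>Z\<close> first with the value of \<open>X\<close> held fixed.
\<close>

lemma (in prob_space) nn_integral_fresh:
  assumes X: "X \<in> measurable G S" and G: "subalgebra M G" and Z: "Z \<in> measurable M N"
    and indep: "indep_set (sets G) (sets (vimage_algebra (space M) Z N))"
    and \<Psi>: "(\<lambda>(x, z). \<Psi> x z) \<in> borel_measurable (S \<Otimes>\<^sub>M N)"
  shows "(\<integral>\<^sup>+ w. \<Psi> (X w) (Z w) \<partial>M) = (\<integral>\<^sup>+ w. (\<integral>\<^sup>+ w'. \<Psi> (X w) (Z w') \<partial>M) \<partial>M)"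
proof -
  have XM: "X \<in> measurable M S"
    using G X by (rule measurable_from_subalg)
  have GM: "space M = space G"
    using G by (simp add: subalgebra_def)
  interpret X: prob_space "distr M S X"
    using XM by (rule prob_space_distr)
  interpret Z: prob_space "distr M N Z"
    using Z by (rule prob_space_distr)
  have prod: "distr M S X \<Otimes>\<^sub>M distr M N Z = distr M (S \<Otimes>\<^sub>M N) (\<lambda>w. (X w, Z w))"
  proof (rule pair_measure_eqI)
    fix A B assume "A \<in> sets (distr M S X)" "B \<in> sets (distr M N Z)"
    then have A: "A \<in> sets S" and B: "B \<in> sets N"
      by simp_all
    have "X -` A \<inter> space M \<in> sets G"
      using X A GM by (simp add: measurable_sets)
    moreover have "Z -` B \<inter> space M \<in> sets (vimage_algebra (space M) Z N)"
      using B by (rule in_vimage_algebra)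
    ultimately have "prob ((X -` A \<inter> space M) \<inter> (Z -` B \<inter> space M))
        = prob (X -` A \<inter> space M) * prob (Z -` B \<inter> space M)"
      by (rule indep_setD[OF indep])
    moreover have "(\<lambda>w. (X w, Z w)) -` (A \<times> B) \<inter> space M = (X -` A \<inter> space M) \<inter> (Z -` B \<inter> space M)"
      by auto
    ultimately show "emeasure (distr M S X) A * emeasure (distr M N Z) B
        = emeasure (distr M (S \<Otimes>\<^sub>M N) (\<lambda>w. (X w, Z w))) (A \<times> B)"
      using XM Z A B by (simp add: emeasure_distr emeasure_eq_measure ennreal_mult'')
  qed (use X.sigma_finite_measure Z.sigma_finite_measure in \<open>simp_all cong: sets_pair_measure_cong\<close>)
  have \<Psi>': "(\<lambda>(x, z). \<Psi> x z) \<in> borel_measurable (distr M S X \<Otimes>\<^sub>M distr M N Z)"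
    using \<Psi> by (simp cong: measurable_cong_sets sets_pair_measure_cong)
  have inner: "(\<lambda>x. \<integral>\<^sup>+ z. \<Psi> x z \<partial>distr M N Z) \<in> borel_measurable S"
    using Z.borel_measurable_nn_integral_fst[OF \<Psi>'] by simp
  have "(\<integral>\<^sup>+ w. \<Psi> (X w) (Z w) \<partial>M)
      = (\<integral>\<^sup>+ p. (\<lambda>(x, z). \<Psi> x z) p \<partial>distr M (S \<Otimes>\<^sub>M N) (\<lambda>w. (X w, Z w)))"
    using XM Z \<Psi> by (subst nn_integral_distr) auto
  also have "\<dots> = (\<integral>\<^sup>+ x. \<integral>\<^sup>+ z. \<Psi> x z \<partial>distr M N Z \<partial>distr M S X)"
    unfolding prod[symmetric] by (subst Z.nn_integral_fst[OF \<Psi>', symmetric]) simp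
  also have "\<dots> = (\<integral>\<^sup>+ w. \<integral>\<^sup>+ z. \<Psi> (X w) z \<partial>distr M N Z \<partial>M)"
    using XM inner by (subst nn_integral_distr) auto
  also have "\<dots> = (\<integral>\<^sup>+ w. (\<integral>\<^sup>+ w'. \<Psi> (X w) (Z w') \<partial>M) \<partial>M)"
  proof (rule nn_integral_cong)
    fix w assume "w \<in> space M"
    then have "X w \<in> space S"
      using XM by (auto dest: measurable_space)
    then have "(\<lambda>z. \<Psi> (X w) z) \<in> borel_measurable N"
      using measurable_Pair2[OF \<Psi>] by simp
    then show "(\<integral>\<^sup>+ z. \<Psi> (X w) z \<partial>distr M N Z) = (\<integral>\<^sup>+ w'. \<Psi> (X w) (Z w') \<partial>M)"
      using Z by (subst nn_integral_distr) auto
  qed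
  finally show ?thesis .
qed

text \<open>
  The oracle is described on the sample spaces \<open>D i\<close>; as the sample of a round has law
  \<open>D i\<close>, the same moments hold on \<open>M\<close>.
\<close>

lemma fresh_samples_oracle:
  assumes prob: "prob_space M" and samples: "fresh_samples M F H D g \<xi>"
    and oracle_ass: "stochastic_oracle H D f g \<sigma>" and i: "i \<in> H"
  shows "integrable M (\<lambda>w. g i x (\<xi> i (Suc t) w))" and "(\<integral>w. g i x (\<xi> i (Suc t) w) \<partial>M) = gradient (f i) x"
    and "integrable M (\<lambda>w. (norm (g i x (\<xi> i (Suc t) w) - gradient (f i) x))\<^sup>2)"
    and "(\<integral>w. (norm (g i x (\<xi> i (Suc t) w) - gradient (f i) x))\<^sup>2 \<partial>M) \<le> \<sigma>\<^sup>2"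
proof -
  have sub: "subalgebra M (F (Suc t))" and \<xi>F: "\<xi> i (Suc t) \<in> measurable (F (Suc t)) (D i)"
    and D: "distr M (D i) (\<xi> i (Suc t)) = D i"
    using samples i by (auto simp: fresh_samples_def)
  have \<xi>: "\<xi> i (Suc t) \<in> measurable M (D i)"
    using sub \<xi>F by (rule measurable_from_subalg)
  have o: "integrable (D i) (g i x)" "(\<integral>z. g i x z \<partial>D i) = gradient (f i) x"
    "integrable (D i) (\<lambda>z. (norm (g i x z - gradient (f i) x))\<^sup>2)"
    "(\<integral>z. (norm (g i x z - gradient (f i) x))\<^sup>2 \<partial>D i) \<le> \<sigma>\<^sup>2"
    using oracle_ass i by (auto simp: stochastic_oracle_def)
  note m = borel_measurable_integrable[OF o(1)] borel_measurable_integrable[OF o(3)]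
  show "integrable M (\<lambda>w. g i x (\<xi> i (Suc t) w))" "integrable M (\<lambda>w. (norm (g i x (\<xi> i (Suc t) w) - gradient (f i) x))\<^sup>2)"
    using o(1,3) integrable_distr_eq[OF \<xi> m(1)] integrable_distr_eq[OF \<xi> m(2)]
    unfolding D by simp_all
  show "(\<integral>w. g i x (\<xi> i (Suc t) w) \<partial>M) = gradient (f i) x" "(\<integral>w. (norm (g i x (\<xi> i (Suc t) w) - gradient (f i) x))\<^sup>2 \<partial>M) \<le> \<sigma>\<^sup>2"
    using o(2,4) integral_distr[OF \<xi> m(1)] integral_distr[OF \<xi> m(2)]
    unfolding D by simp_all
qed

section \<open>Contraction of the expected gap in one round\<close>

text \<open>
  The coefficient of \<open>- \<gamma> n\<close> on the left, where \<open>n\<close> is the squared norm of the gradient, is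
  \<open>\<rho> = 1 / 2 - L \<gamma> - \<kappa> B\<^sup>2 (1 / 2 + L \<gamma>)\<close>. The bound on \<open>L \<gamma>\<close> gives
  \<open>\<rho> \<ge> r\<close>, and \<open>r \<ge> 0\<close> allows the lower bound on \<open>n\<close> to be inserted.
\<close>

lemma PL_contraction:
  fixes c :: real
  assumes PL: "n \<ge> 2 * \<mu> * c" and c: "c \<ge> 0" and \<mu>: "\<mu> \<ge> 0" and L: "L \<ge> 0" and \<kappa>: "\<kappa> \<ge> 0"
    and \<gamma>: "0 \<le> \<gamma>" "L * \<gamma> \<le> \<delta>" and h: "h > 0"
    and r: "r = 1 / 2 - 2 * \<delta> - \<kappa> * B\<^sup>2 * (1 / 2 + \<delta>)" "r \<ge> 0"
  shows "c - \<gamma> / 2 * n + L * \<gamma>\<^sup>2 * (n + \<sigma>\<^sup>2 / h) + (\<gamma> / 2 + L * \<gamma>\<^sup>2) * \<kappa> * (G\<^sup>2 + B\<^sup>2 * n + \<sigma>\<^sup>2)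
    \<le> (1 - 2 * \<mu> * r * \<gamma>) * c + L * (2 * \<sigma>\<^sup>2 / h + \<kappa> * \<sigma>\<^sup>2 + \<kappa> * G\<^sup>2) * \<gamma>\<^sup>2
       + 1 / 2 * (\<kappa> * \<sigma>\<^sup>2 + \<kappa> * G\<^sup>2) * \<gamma>"
proof -
  define \<rho> where "\<rho> = 1 / 2 - L * \<gamma> - \<kappa> * B\<^sup>2 * (1 / 2 + L * \<gamma>)"
  have n: "n \<ge> 0"
    using PL c \<mu> by (smt (verit) mult_nonneg_nonneg)
  have "\<delta> \<ge> 0"
    using \<gamma> L by (smt (verit) mult_nonneg_nonneg)
  moreover have "\<kappa> * B\<^sup>2 * (1 / 2 + L * \<gamma>) \<le> \<kappa> * B\<^sup>2 * (1 / 2 + \<delta>)"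
    using \<gamma> \<kappa> by (intro mult_left_mono) auto
  ultimately have "r \<le> \<rho>"
    using \<gamma> unfolding \<rho>_def r by linarith
  then have "(\<gamma> * r) * (2 * \<mu> * c) \<le> (\<gamma> * \<rho>) * n"
    using PL \<gamma> r n c \<mu> by (intro mult_mono) auto
  \<comment> \<open>On the right \<open>L \<gamma>\<^sup>2 \<sigma>\<^sup>2 / h\<close> occurs twice, on the left once.\<close>
  moreover have "L * (\<sigma>\<^sup>2 / h) * \<gamma>\<^sup>2 \<ge> 0"
    using L h by simp
  ultimately show ?thesis
    unfolding \<rho>_def by (simp add: algebra_simps power2_eq_square)
qed

lemma integral_le_of_nn_integral_le:
  fixes f g :: "'a \<Rightarrow> real"
  assumes f: "f \<in> borel_measurable M" "\<And>x. f x \<ge> 0" and g: "integrable M g" "\<And>x. g x \<ge> 0"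
    and le: "(\<integral>\<^sup>+ x. ennreal (f x) \<partial>M) \<le> (\<integral>\<^sup>+ x. ennreal (g x) \<partial>M)"
  shows "integrable M f" and "integral\<^sup>L M f \<le> integral\<^sup>L M g"
proof -
  have eq: "(\<integral>\<^sup>+ x. ennreal (g x) \<partial>M) = ennreal (integral\<^sup>L M g)"
    using g by (simp add: nn_integral_eq_integral)
  with le have "(\<integral>\<^sup>+ x. ennreal (f x) \<partial>M) < \<infinity>"
    by (simp add: le_less_trans)
  with f show int: "integrable M f"
    by (intro integrableI_nonneg) auto
  with f g le eq show "integral\<^sup>L M f \<le> integral\<^sup>L M g"
    by (simp add: nn_integral_eq_integral ennreal_le_iff integral_nonneg)
qed

text \<open>
  The Byzantine vectors \<open>v\<close> may depend on anything, including the fresh samples. They disappear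
  in the passage to the majorant \<open>\<Phi>\<close>, which is a measurable function of the current iterate
  and of the fresh honest samples, so that independence of the past applies to it.
\<close>

lemma rdsgd_one_step:
  fixes f :: "'n::finite \<Rightarrow> real ^ 'd \<Rightarrow> real" and A :: "(real ^ 'd) ^ 'n \<Rightarrow> real ^ 'd"
  assumes card: "card H = CARD('n) - b"
    and f_diff: "\<And>i x. i \<in> H \<Longrightarrow> f i differentiable (at x)"
    and fH: "fH = global_objective H f" and bdd: "bdd_below (range fH)"
    and smooth: "L_smooth L fH" and PL: "PL_condition \<mu> fH"
    and dissim: "bounded_dissimilarity G B H f"
    and oracle_ass: "stochastic_oracle H D f g \<sigma>" and robust: "robust_aggregation b \<kappa> A"
    and prob: "prob_space M" and samples: "fresh_samples M F H D g \<xi>"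
    and X: "X \<in> borel_measurable (F t)" and X': "X' \<in> borel_measurable M"
    and step: "\<And>w. X' w = X w - \<gamma> *\<^sub>R A (\<chi> i. if i \<in> H then g i (X w) (\<xi> i (Suc t) w) else v i w)"
    and \<gamma>: "0 \<le> \<gamma>" "L * \<gamma> \<le> \<delta>"
    and r: "r = 1 / 2 - 2 * \<delta> - \<kappa> * B\<^sup>2 * (1 / 2 + \<delta>)" "r \<ge> 0"
    and int: "integrable M (\<lambda>w. fH (X w))"
  shows "integrable M (\<lambda>w. fH (X' w))"
    and "(\<integral>w. fH (X' w) \<partial>M) - Inf (range fH)
      \<le> (1 - 2 * \<mu> * r * \<gamma>) * ((\<integral>w. fH (X w) \<partial>M) - Inf (range fH))
         + L * (2 * \<sigma>\<^sup>2 / real (card H) + \<kappa> * \<sigma>\<^sup>2 + \<kappa> * G\<^sup>2) * \<gamma>\<^sup>2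
         + 1 / 2 * (\<kappa> * \<sigma>\<^sup>2 + \<kappa> * G\<^sup>2) * \<gamma>"
proof -
  interpret prob_space M by (rule prob)
  let ?fs = "Inf (range fH)" and ?Df = "gradient fH" and ?N = "PiM H D"
  have L: "L > 0" and \<kappa>: "\<kappa> > 0" and b: "2 * b < CARD('n)" and \<mu>: "\<mu> > 0"
    using smooth robust PL by (auto simp: L_smooth_def robust_aggregation_def PL_condition_def)
  have h: "card H > 0"
    using card b by simp
  have fs: "?fs \<le> fH x" for x
    using bdd by (intro cInf_lower) auto

  define u where "u i x w = g i x (\<xi> i (Suc t) w)" for i x w
  define Z where "Z w = (\<lambda>i\<in>H. \<xi> i (Suc t) w)" for w
  define \<Phi> where "\<Phi> x z = step_majorant L \<kappa> \<gamma> H (fH x) (?Df x) (\<lambda>i. g i x (z i)) - ?fs" for x z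
  have \<Phi>_Z: "\<Phi> x (Z w) = step_majorant L \<kappa> \<gamma> H (fH x) (?Df x) (\<lambda>i. u i x w) - ?fs" for x w
    by (simp add: \<Phi>_def Z_def u_def step_majorant_def)
  have maj: "fH (x - \<gamma> *\<^sub>R A y) - ?fs \<le> \<Phi> x z" if "\<And>i. i \<in> H \<Longrightarrow> y $ i = g i x (z i)" for x y z
    unfolding \<Phi>_def using step_majorant_upper_bound[OF smooth robust card \<gamma>(1), of y "\<lambda>i. g i x (z i)" x] that
    by simp
  \<comment> \<open>\<open>\<Phi> x z\<close> dominates the gap at the point reached from \<open>x\<close> when the Byzantine workers also
    send \<open>g i x (z i)\<close>.\<close>
  have \<Phi>_nonneg: "\<Phi> x z \<ge> 0" for x z
  proof -
    have "0 \<le> fH (x - \<gamma> *\<^sub>R A (\<chi> i. g i x (z i))) - ?fs"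
      using fs by simp
    also have "\<dots> \<le> \<Phi> x z"
      by (rule maj) simp
    finally show ?thesis .
  qed

  define R where "R x = (1 - 2 * \<mu> * r * \<gamma>) * (fH x - ?fs)
      + L * (2 * \<sigma>\<^sup>2 / real (card H) + \<kappa> * \<sigma>\<^sup>2 + \<kappa> * G\<^sup>2) * \<gamma>\<^sup>2
      + 1 / 2 * (\<kappa> * \<sigma>\<^sup>2 + \<kappa> * G\<^sup>2) * \<gamma>" for x
  have indep_u: "indep_vars (\<lambda>_. borel) (\<lambda>i. u i x) H" for x
    using samples by (simp add: fresh_samples_def u_def[abs_def])
  have Df: "?Df x = (1 / real (card H)) *\<^sub>R (\<Sum>i\<in>H. gradient (f i) x)" for x
    unfolding fH using f_diff by (intro gradient_global_objective) auto
  have step_x: "integrable M (\<lambda>w. \<Phi> x (Z w))" "(\<integral>w. \<Phi> x (Z w) \<partial>M) \<le> R x" for x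
  proof -
    have V: "(\<Sum>i\<in>H. (norm (gradient (f i) x - ?Df x))\<^sup>2) / real (card H) \<le> G\<^sup>2 + B\<^sup>2 * (norm (?Df x))\<^sup>2"
      using dissim by (simp add: bounded_dissimilarity_def fH)
    have "H \<noteq> {}"
      using h by auto
    note E = expectation_step_majorant_le[OF finite this indep_u[of x],
        OF fresh_samples_oracle[OF prob samples oracle_ass, of _ x t, folded u_def] Df V, simplified,
        OF less_imp_le[OF L] less_imp_le[OF \<kappa>] \<gamma>(1), of "fH x"]
    show "integrable M (\<lambda>w. \<Phi> x (Z w))"
      unfolding \<Phi>_Z using E(1) by simp
    have "(\<integral>w. \<Phi> x (Z w) \<partial>M)
        \<le> (fH x - ?fs) - \<gamma> / 2 * (norm (?Df x))\<^sup>2 + L * \<gamma>\<^sup>2 * ((norm (?Df x))\<^sup>2 + \<sigma>\<^sup>2 / real (card H))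
         + (\<gamma> / 2 + L * \<gamma>\<^sup>2) * \<kappa> * (G\<^sup>2 + B\<^sup>2 * (norm (?Df x))\<^sup>2 + \<sigma>\<^sup>2)"
      unfolding \<Phi>_Z using E by (simp add: prob_space)
    also have "\<dots> \<le> R x"
      unfolding R_def using PL fs[of x] \<mu> L \<kappa> h
      by (intro PL_contraction[OF _ _ _ _ _ \<gamma> _ r]) (auto simp: PL_condition_def)
    finally show "(\<integral>w. \<Phi> x (Z w) \<partial>M) \<le> R x" .
  qed
  have R_nonneg: "R x \<ge> 0" for x
    using step_x(2)[of x] \<Phi>_nonneg by (meson Bochner_Integration.integral_nonneg order_trans)

  have Z: "Z \<in> measurable M ?N"
    unfolding Z_def[abs_def]
  proof (rule measurable_restrict)
    fix i assume "i \<in> H"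
    then have "subalgebra M (F (Suc t))" "\<xi> i (Suc t) \<in> measurable (F (Suc t)) (D i)"
      using samples by (auto simp: fresh_samples_def)
    then show "\<xi> i (Suc t) \<in> measurable M (D i)"
      by (rule measurable_from_subalg)
  qed
  have g: "(\<lambda>p. g i (fst p) (snd p i)) \<in> borel_measurable (borel \<Otimes>\<^sub>M ?N)" if "i \<in> H" for i
  proof -
    have gi: "(\<lambda>(x, z). g i x z) \<in> borel_measurable (borel \<Otimes>\<^sub>M D i)"
      using oracle_ass that by (auto simp: stochastic_oracle_def)
    have "(\<lambda>p. (fst p, snd p i)) \<in> measurable (borel \<Otimes>\<^sub>M ?N) (borel \<Otimes>\<^sub>M D i)"
      using that by (intro measurable_Pair measurable_fst measurable_compose[OF measurable_snd]
          measurable_component_singleton)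
    from measurable_compose[OF this gi] show ?thesis
      by simp
  qed
  note [measurable] = borel_measurable_L_smooth[OF smooth]
  have \<Phi>: "(\<lambda>(x, z). ennreal (\<Phi> x z)) \<in> borel_measurable (borel \<Otimes>\<^sub>M ?N)"
    unfolding \<Phi>_def step_majorant_def Let_def case_prod_beta using g by measurable
  have sub: "subalgebra M (F t)" for t
    using samples by (auto simp: fresh_samples_def)
  have "(\<integral>\<^sup>+ w. ennreal (fH (X' w) - ?fs) \<partial>M) \<le> (\<integral>\<^sup>+ w. ennreal (\<Phi> (X w) (Z w)) \<partial>M)"
    unfolding step by (intro nn_integral_mono ennreal_leI maj) (simp add: Z_def)
  also have "\<dots> = (\<integral>\<^sup>+ w. (\<integral>\<^sup>+ w'. ennreal (\<Phi> (X w) (Z w')) \<partial>M) \<partial>M)"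
    using samples unfolding Z_def[abs_def]
    by (intro nn_integral_fresh[OF X sub Z[unfolded Z_def[abs_def]] _ \<Phi>]) (simp add: fresh_samples_def)
  also have "\<dots> \<le> (\<integral>\<^sup>+ w. ennreal (R (X w)) \<partial>M)"
    using step_x \<Phi>_nonneg by (intro nn_integral_mono) (simp add: nn_integral_eq_integral ennreal_leI)
  finally have le: "(\<integral>\<^sup>+ w. ennreal (fH (X' w) - ?fs) \<partial>M) \<le> (\<integral>\<^sup>+ w. ennreal (R (X w)) \<partial>M)" .
  have meas: "(\<lambda>w. fH (X' w) - ?fs) \<in> borel_measurable M"
    using X' by measurable
  have intR: "integrable M (\<lambda>w. R (X w))"
    unfolding R_def using int by simp
  note final = integral_le_of_nn_integral_le[OF meas _ intR R_nonneg le]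
  have "integrable M (\<lambda>w. fH (X' w) - ?fs)"
    using final(1) fs by simp
  then have "integrable M (\<lambda>w. (fH (X' w) - ?fs) + ?fs)"
    by (intro Bochner_Integration.integrable_add) auto
  then show int': "integrable M (\<lambda>w. fH (X' w))"
    by simp
  have "(\<integral>w. fH (X' w) - ?fs \<partial>M) \<le> (\<integral>w. R (X w) \<partial>M)"
    using final(2) fs by simp
  then show "(\<integral>w. fH (X' w) \<partial>M) - ?fs
      \<le> (1 - 2 * \<mu> * r * \<gamma>) * ((\<integral>w. fH (X w) \<partial>M) - ?fs)
         + L * (2 * \<sigma>\<^sup>2 / real (card H) + \<kappa> * \<sigma>\<^sup>2 + \<kappa> * G\<^sup>2) * \<gamma>\<^sup>2
         + 1 / 2 * (\<kappa> * \<sigma>\<^sup>2 + \<kappa> * G\<^sup>2) * \<gamma>"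
    using int int' unfolding R_def by (simp add: prob_space)
qed

section \<open>The two phases of the stepsizes\<close>

text \<open>
  The constant phase is followed for \<open>T div 2 - 1\<close> steps only. The decreasing phase then starts
  with \<open>s = s0\<close>, so that the telescoped sum begins with \<open>(s0 - 1)\<^sup>2\<close>. For \<open>T = 1\<close> there is
  no round at all, and the exponent in the bound is positive.
\<close>

lemma two_phase_stepsize_bound:
  fixes a :: "nat \<Rightarrow> real"
  assumes nonneg: "\<And>t. a t \<ge> 0"
    and rec: "\<And>t. a (Suc t) \<le> (1 - \<alpha>1 * \<gamma> (Suc t)) * a t + \<alpha>2 * (\<gamma> (Suc t))\<^sup>2 + \<alpha>3 * \<gamma> (Suc t)"
    and \<alpha>: "\<alpha>1 > 0" "\<alpha>2 \<ge> 0" "\<alpha>3 \<ge> 0"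
    and T: "T > 0" and s0: "s0 > 2" and \<gamma>0: "\<gamma>0 = 2 / (\<alpha>1 * s0)"
    and \<gamma>: "\<And>t. \<gamma> t = (if t < T div 2 then \<gamma>0 else 2 / (\<alpha>1 * (s0 + real t - real (T div 2))))"
  shows "a (T - 1) \<le> (s0 - 1)\<^sup>2 * a 0 * (4 * exp (- \<alpha>1 * \<gamma>0 * (real (T div 2) - 1)) / (real T)\<^sup>2)
        + 4 * (\<alpha>2 * \<gamma>0 + \<alpha>3) * (s0 - 1)\<^sup>2 / (\<alpha>1 * (real T)\<^sup>2)
        + 8 * \<alpha>2 / (\<alpha>1\<^sup>2 * real T) + 2 * \<alpha>3 / \<alpha>1"
    (is "_ \<le> ?bias + ?early + ?late + ?floor")
proof -
  have \<gamma>0_pos: "\<gamma>0 > 0"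
    using \<alpha> s0 by (simp add: \<gamma>0)
  have nn: "?early \<ge> 0" "?late \<ge> 0" "?floor \<ge> 0"
    using \<alpha> \<gamma>0_pos by auto
  consider "T = 1" | K where "T div 2 = Suc K"
    using T by (cases "T div 2") (auto simp: div_eq_0_iff)
  then show ?thesis
  proof cases
    case 1
    have "1 * a 0 * 1 \<le> (s0 - 1)\<^sup>2 * a 0 * (4 * exp (\<alpha>1 * \<gamma>0))"
      using s0 nonneg[of 0] \<alpha> \<gamma>0_pos one_le_exp_iff[of "\<alpha>1 * \<gamma>0"]
      by (intro mult_mono) (auto simp del: one_le_exp_iff simp: mult_nonneg_nonneg)
    then show ?thesis
      using 1 nn by simp
  next
    case (2 K)
    define q where "q = 1 - \<alpha>1 * \<gamma>0"
    have q: "0 \<le> q"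
      using s0 \<alpha> by (simp add: q_def \<gamma>0 field_simps)
    have phase1: "a t \<le> q ^ t * a 0 + (\<alpha>2 * \<gamma>0 + \<alpha>3) / \<alpha>1" if "t \<le> K" for t
      using that
    proof (induction t)
      case 0
      then show ?case using \<alpha> \<gamma>0_pos by simp
    next
      case (Suc t)
      have "a (Suc t) \<le> q * a t + \<alpha>2 * \<gamma>0\<^sup>2 + \<alpha>3 * \<gamma>0"
        using rec[of t] Suc.prems 2 by (simp add: \<gamma> q_def)
      also have "\<dots> \<le> q * (q ^ t * a 0 + (\<alpha>2 * \<gamma>0 + \<alpha>3) / \<alpha>1) + \<alpha>2 * \<gamma>0\<^sup>2 + \<alpha>3 * \<gamma>0"
        using Suc q by (intro add_right_mono mult_left_mono) auto
      also have "\<dots> = q ^ Suc t * a 0 + (\<alpha>2 * \<gamma>0 + \<alpha>3) / \<alpha>1"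
        using \<alpha> by (simp add: q_def field_simps power2_eq_square)
      finally show ?case .
    qed
    have "q ^ K \<le> exp (- \<alpha>1 * \<gamma>0) ^ K"
      using q exp_ge_add_one_self[of "- \<alpha>1 * \<gamma>0"] by (intro power_mono) (auto simp: q_def)
    also have "\<dots> = exp (- \<alpha>1 * \<gamma>0 * real K)"
      by (simp add: exp_of_nat_mult[symmetric] mult_ac)
    finally have aK: "a K \<le> exp (- \<alpha>1 * \<gamma>0 * real K) * a 0 + (\<alpha>2 * \<gamma>0 + \<alpha>3) / \<alpha>1"
      using phase1[of K] nonneg[of 0] by (smt (verit) mult_right_mono order_refl)
    \<comment> \<open>After \<open>j\<close> further rounds \<open>s = s0 + j - 1\<close>. Multiplied by \<open>s\<^sup>2\<close>, the noise terms of a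
      round become \<open>4 \<alpha>2 / \<alpha>1\<^sup>2\<close> and \<open>s \<cdot> 2 \<alpha>3 / \<alpha>1\<close>; each of the \<open>j\<close> values of \<open>s\<close>
      in the sum of the latter is estimated by the last one.\<close>
    have phase2: "(s0 + real j - 1)\<^sup>2 * a (K + j) \<le> (s0 - 1)\<^sup>2 * a K + real j * (4 * \<alpha>2 / \<alpha>1\<^sup>2)
        + real j * (s0 + real j - 1) * (2 * \<alpha>3 / \<alpha>1)" for j
    proof (induction j)
      case 0
      then show ?case by simp
    next
      case (Suc j)
      define s where "s = s0 + real j"
      have s: "s > 2"
        using s0 by (simp add: s_def)
      have "\<gamma> (Suc (K + j)) = 2 / (\<alpha>1 * s)"
        using 2 by (simp add: \<gamma> s_def)
      then have "a (Suc (K + j)) \<le> (1 - 2 / s) * a (K + j) + 4 * \<alpha>2 / \<alpha>1\<^sup>2 / s\<^sup>2 + 2 * \<alpha>3 / \<alpha>1 / s"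
        using rec[of "K + j"] \<alpha> by (simp add: power_divide power_mult_distrib mult_ac)
      then have "s\<^sup>2 * a (Suc (K + j))
          \<le> s\<^sup>2 * ((1 - 2 / s) * a (K + j) + 4 * \<alpha>2 / \<alpha>1\<^sup>2 / s\<^sup>2 + 2 * \<alpha>3 / \<alpha>1 / s)"
        by (intro mult_left_mono) auto
      also have "\<dots> = (s\<^sup>2 - 2 * s) * a (K + j) + 4 * \<alpha>2 / \<alpha>1\<^sup>2 + s * (2 * \<alpha>3 / \<alpha>1)"
        using s \<alpha> by (simp add: field_simps power2_eq_square)
      also have "(s\<^sup>2 - 2 * s) * a (K + j) \<le> (s - 1)\<^sup>2 * a (K + j)"
        using nonneg by (intro mult_right_mono) (auto simp: power2_eq_square algebra_simps)
      also have "(s - 1)\<^sup>2 * a (K + j) \<le> (s0 - 1)\<^sup>2 * a K + real j * (4 * \<alpha>2 / \<alpha>1\<^sup>2)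
          + real j * (s - 1) * (2 * \<alpha>3 / \<alpha>1)"
        using Suc.IH by (simp add: s_def)
      also have "real j * (s - 1) * (2 * \<alpha>3 / \<alpha>1) \<le> real j * s * (2 * \<alpha>3 / \<alpha>1)"
        using \<alpha> by (intro mult_right_mono mult_left_mono) auto
      finally show ?case
        by (simp add: s_def algebra_simps add_divide_distrib)
    qed
    define j where "j = T - 1 - K"
    define s where "s = s0 + real j - 1"
    have KT: "2 * Suc K \<le> T" and TK: "T \<le> 2 * Suc K + 1"
      using 2 by presburger+
    have j: "K + j = T - 1" and s_j: "s \<ge> real j" and s_T: "s \<ge> real T / 2" and s_pos: "s > 0"
      using KT TK s0 T by (auto simp: j_def s_def of_nat_diff)
    have "real j / s \<le> 1" "1 / s \<le> 2 / real T"
      using s_j s_T s_pos T by (auto simp: field_simps)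
    have sq: "1 / s\<^sup>2 \<le> 4 / (real T)\<^sup>2"
      using power_mono[OF \<open>1 / s \<le> 2 / real T\<close>, of 2] s_pos by (simp add: power_divide)
    define R where "R = (s0 - 1)\<^sup>2 * (exp (- \<alpha>1 * \<gamma>0 * real K) * a 0 + (\<alpha>2 * \<gamma>0 + \<alpha>3) / \<alpha>1)"
    have R: "R \<ge> 0"
      unfolding R_def using nonneg[of 0] \<alpha> \<gamma>0_pos
      by (intro mult_nonneg_nonneg add_nonneg_nonneg divide_nonneg_pos) auto
    have "a (T - 1) = s\<^sup>2 * a (K + j) / s\<^sup>2"
      using s_pos j by simp
    also have "\<dots> \<le> (R + real j * (4 * \<alpha>2 / \<alpha>1\<^sup>2) + real j * s * (2 * \<alpha>3 / \<alpha>1)) / s\<^sup>2"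
      using phase2[of j] mult_left_mono[OF aK, of "(s0 - 1)\<^sup>2"]
      by (intro divide_right_mono) (auto simp: R_def s_def)
    also have "\<dots> = R * (1 / s\<^sup>2) + (real j / s) * (1 / s) * (4 * \<alpha>2 / \<alpha>1\<^sup>2) + (real j / s) * (2 * \<alpha>3 / \<alpha>1)"
      using s_pos \<alpha> by (simp add: field_simps power2_eq_square)
    also have "\<dots> \<le> R * (4 / (real T)\<^sup>2) + 1 * (2 / real T) * (4 * \<alpha>2 / \<alpha>1\<^sup>2) + 1 * (2 * \<alpha>3 / \<alpha>1)"
      using R sq \<open>real j / s \<le> 1\<close> \<open>1 / s \<le> 2 / real T\<close> \<alpha> s_pos
      by (intro add_mono mult_mono mult_left_mono mult_right_mono) auto
    also have "R * (4 / (real T)\<^sup>2) = ?bias + ?early"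
      using 2 by (simp add: R_def algebra_simps add_divide_distrib)
    finally show ?thesis
      by (simp add: mult_ac)
  qed
qed

section \<open>Convergence of robust distributed SGD\<close>

theorem theoremA5:
  fixes M :: "'w measure" and F :: "nat \<Rightarrow> 'w measure"
    and H :: "'n::finite set" and b h :: nat
    and D :: "'n \<Rightarrow> 'z measure" and loss :: "real ^ 'd \<Rightarrow> 'z \<Rightarrow> real"
    and f :: "'n \<Rightarrow> real ^ 'd \<Rightarrow> real" and fH :: "real ^ 'd \<Rightarrow> real"
    and g :: "'n \<Rightarrow> real ^ 'd \<Rightarrow> 'z \<Rightarrow> real ^ 'd"
    and A :: "(real ^ 'd) ^ 'n \<Rightarrow> real ^ 'd"
    and \<xi> :: "'n \<Rightarrow> nat \<Rightarrow> 'w \<Rightarrow> 'z" and byz :: "'n \<Rightarrow> nat \<Rightarrow> 'w \<Rightarrow> real ^ 'd"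
    and x0 :: "real ^ 'd" and X :: "nat \<Rightarrow> 'w \<Rightarrow> real ^ 'd"
    and L \<mu> G B \<sigma> \<kappa> \<delta> \<alpha>1 \<alpha>2 \<alpha>3 s0 \<gamma>0 :: real
    and \<gamma> :: "nat \<Rightarrow> real" and T :: nat
  assumes byzantine: "2 * b < CARD('n)"
    and honest: "card H = CARD('n) - b" and h_def: "h = CARD('n) - b"
    and data: "\<forall>i\<in>H. prob_space (D i) \<and> (\<forall>x. integrable (D i) (loss x))"
    and f_def: "f = local_objective D loss"
    and f_diff: "\<forall>i\<in>H. \<forall>x. f i differentiable (at x)"
    and fH_def: "fH = global_objective H f"
    and fH_bdd: "bdd_below (range fH)"
    and smooth: "L_smooth L fH"
    and PL: "PL_condition \<mu> fH"
    and dissim: "bounded_dissimilarity G B H f"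
    and oracle_ass: "stochastic_oracle H D f g \<sigma>"
    and robust: "robust_aggregation b \<kappa> A"
    and prob: "prob_space M"
    and samples: "fresh_samples M F H D g \<xi>"
    and X_def: "X = (\<lambda>t w. rdsgd H A g \<gamma> x0 (\<lambda>i t. \<xi> i t w) (\<lambda>j t. byz j t w) t)"
    and adapted: "\<forall>t. X t \<in> borel_measurable (F t)"
    and \<delta>: "0 < \<delta>" "\<delta> < 1 / 4"
    and \<alpha>1_def: "\<alpha>1 = 2 * \<mu> * (1 / 2 - 2 * \<delta> - \<kappa> * B\<^sup>2 * (1 / 2 + \<delta>))"
    and \<alpha>2_def: "\<alpha>2 = L * (2 * \<sigma>\<^sup>2 / real h + \<kappa> * \<sigma>\<^sup>2 + \<kappa> * G\<^sup>2)"
    and \<alpha>3_def: "\<alpha>3 = 1 / 2 * (\<kappa> * \<sigma>\<^sup>2 + \<kappa> * G\<^sup>2)"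
    and \<kappa>B: "\<kappa> * B\<^sup>2 < (1 - 4 * \<delta>) / (1 + 2 * \<delta>)"
    and T: "T > 0"
    and \<gamma>_def: "\<forall>t. \<gamma> t = (if t < T div 2 then \<gamma>0
                  else 2 / (\<alpha>1 * (s0 + real t - real (T div 2))))"
    and s0: "s0 > max (2 * L / (\<delta> * \<alpha>1)) 2"
    and \<gamma>0: "\<gamma>0 = 2 / (\<alpha>1 * s0)" "\<gamma>0 < min (1 / \<alpha>1) (\<delta> / L)"
  shows "integrable M (\<lambda>w. fH (X (T - 1) w)) \<and>
    (\<integral>w. fH (X (T - 1) w) \<partial>M) - Inf (range fH)
      \<le> (s0 - 1)\<^sup>2 * (fH x0 - Inf (range fH)) *
            (4 * exp (- \<alpha>1 * \<gamma>0 * (real (T div 2) - 1)) / (real T)\<^sup>2)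
        + 4 * (\<alpha>2 * \<gamma>0 + \<alpha>3) * (s0 - 1)\<^sup>2 / (\<alpha>1 * (real T)\<^sup>2)
        + 8 * \<alpha>2 / (\<alpha>1\<^sup>2 * real T)
        + 2 * \<alpha>3 / \<alpha>1"
proof -
  interpret prob_space M by (rule prob)
  let ?fs = "Inf (range fH)"
  define r where "r = 1 / 2 - 2 * \<delta> - \<kappa> * B\<^sup>2 * (1 / 2 + \<delta>)"
  have L: "L > 0" and \<mu>: "\<mu> > 0" and \<kappa>: "\<kappa> > 0"
    using smooth PL robust by (auto simp: L_smooth_def PL_condition_def robust_aggregation_def)
  have "\<kappa> * B\<^sup>2 * (1 + 2 * \<delta>) < 1 - 4 * \<delta>"
    using \<kappa>B \<delta> by (simp add: pos_less_divide_eq)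
  then have r: "r > 0"
    by (simp add: r_def algebra_simps)
  have \<alpha>1: "\<alpha>1 = 2 * \<mu> * r"
    by (simp add: \<alpha>1_def r_def)
  have \<alpha>1_pos: "\<alpha>1 > 0"
    using r \<mu> by (simp add: \<alpha>1)
  have \<alpha>: "\<alpha>2 \<ge> 0" "\<alpha>3 \<ge> 0"
    using L \<kappa> by (simp_all add: \<alpha>2_def \<alpha>3_def)
  have s0': "s0 > 2"
    using s0 by simp
  have \<gamma>_nonneg: "\<gamma> t \<ge> 0" and \<gamma>_le: "\<gamma> t \<le> \<gamma>0" for t
    using \<alpha>1_pos s0' by (auto simp: \<gamma>_def \<gamma>0(1) intro!: divide_left_mono mult_pos_pos)
  have L\<gamma>: "L * \<gamma> t \<le> \<delta>" for t
  proof -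
    have "\<gamma> t \<le> \<delta> / L"
      using \<gamma>0(2) \<gamma>_le[of t] by simp
    then show ?thesis
      using L by (simp add: pos_le_divide_eq mult.commute)
  qed
  have meas: "X t \<in> borel_measurable M" for t
    using samples adapted by (auto simp: fresh_samples_def intro: measurable_from_subalg)
  have diff: "\<And>i x. i \<in> H \<Longrightarrow> f i differentiable (at x)"
    using f_diff by blast
  have step: "X (Suc t) w = X t w - \<gamma> (Suc t) *\<^sub>R
      A (\<chi> i. if i \<in> H then g i (X t w) (\<xi> i (Suc t) w) else byz i (Suc t) w)" for t w
    unfolding X_def by simp
  have one_step: "integrable M (\<lambda>w. fH (X (Suc t) w))"
    "(\<integral>w. fH (X (Suc t) w) \<partial>M) - ?fs
      \<le> (1 - 2 * \<mu> * r * \<gamma> (Suc t)) * ((\<integral>w. fH (X t w) \<partial>M) - ?fs)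
         + L * (2 * \<sigma>\<^sup>2 / real (card H) + \<kappa> * \<sigma>\<^sup>2 + \<kappa> * G\<^sup>2) * (\<gamma> (Suc t))\<^sup>2
         + 1 / 2 * (\<kappa> * \<sigma>\<^sup>2 + \<kappa> * G\<^sup>2) * \<gamma> (Suc t)"
    if "integrable M (\<lambda>w. fH (X t w))" for t
    by (rule rdsgd_one_step[OF honest diff fH_def fH_bdd smooth PL dissim oracle_ass robust
        prob samples adapted[rule_format, of t] meas[of "Suc t"] step[of t]
        \<gamma>_nonneg[of "Suc t"] L\<gamma>[of "Suc t"] r_def less_imp_le[OF r] that]; assumption)+
  have X0: "X 0 = (\<lambda>w. x0)"
    by (simp add: X_def fun_eq_iff)
  have int: "integrable M (\<lambda>w. fH (X t w))" for t
  proof (induction t)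
    case 0
    show ?case by (simp add: X0)
  next
    case (Suc t)
    then show ?case by (rule one_step(1))
  qed
  define a where "a t = (\<integral>w. fH (X t w) \<partial>M) - ?fs" for t
  have "?fs \<le> fH x" for x
    using fH_bdd by (intro cInf_lower) auto
  then have a_nonneg: "a t \<ge> 0" for t
    unfolding a_def using int[of t] by (simp add: integral_ge_const)
  have rec: "a (Suc t) \<le> (1 - \<alpha>1 * \<gamma> (Suc t)) * a t + \<alpha>2 * (\<gamma> (Suc t))\<^sup>2 + \<alpha>3 * \<gamma> (Suc t)" for t
    using one_step(2)[OF int[of t]] honest by (simp add: a_def \<alpha>1 \<alpha>2_def \<alpha>3_def h_def)
  have "a 0 = fH x0 - ?fs"
    by (simp add: a_def X0 prob_space)
  with two_phase_stepsize_bound[OF a_nonneg rec \<alpha>1_pos \<alpha> T s0' \<gamma>0(1) \<gamma>_def[rule_format]] int[of "T - 1"]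
  show ?thesis
    by (simp add: a_def)
qed

end
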